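(* Let $T\ge 1$ be an integer, let $c_k:\mathbb{R}^p\times\mathbb{R}^n\to\mathbb{R}$ for $k=0,\dots,T-1$ and $c_T:\mathbb{R}^n\to\mathbb{R}$. For $\mathbf{u}=(u(0),\dots,u(T-1))$ with $u(k)\in\mathbb{R}^p$ and $\mathbf{x}=(x(0),\dots,x(T))$ with $x(k)\in\mathbb{R}^n$, the function $$J(\mathbf{u},\mathbf{x})=\max\Big\{\sup_{0\le k\le T-1}\{c_k(u(k),x(k))\},\;c_T(x(T))\Big\}$$ is a forward separable objective function.
   Context: A function $J(\mathbf{u},\mathbf{x})$ of $\mathbf{u}=(u(0),\dots,u(T-1))\in(\mathbb{R}^p)^T$ and $\mathbf{x}=(x(0),\dots,x(T))\in(\mathbb{R}^n)^{T+1}$ is forward separable if there exist $q\in\mathbb{N}$ and functions $\phi_0:\mathbb{R}^n\times\mathbb{R}^p\to\mathbb{R}^q$, $\phi_t:\mathbb{R}^n\times\mathbb{R}^p\times\mathbb{R}^q\to\mathbb{R}^q$ for $t=1,\dots,T-1$, and $\phi_T:\mathbb{R}^n\times\mathbb{R}^q\to\mathbb{R}$ such that for all $(\mathbf{u},\mathbf{x})$ $$J(\mathbf{u},\mathbf{x})=\phi_T\big(x(T),\phi_{T-1}[x(T-1),u(T-1),\phi_{T-2}\{\dots,\phi_1\{x(1),u(1),\phi_0\{x(0),u(0)\}\}\dots\}]\big).$$ *)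

theory Defs
  imports Complex_Main "HOL-Library.FuncSet" "Jordan_Normal_Form.Matrix"
begin

(* The dimension q of the intermediate state is existentially quantified in the definition of
   forward separability, so Euclidean spaces R^d are rendered throughout as carrier_vec d
   inside the type real vec, rather than with type-level dimensions. *)

definition input_seqs :: "nat \<Rightarrow> nat \<Rightarrow> (nat \<Rightarrow> real vec) set" where
  "input_seqs p T = ({0..<T} \<rightarrow>\<^sub>E carrier_vec p)"

definition state_seqs :: "nat \<Rightarrow> nat \<Rightarrow> (nat \<Rightarrow> real vec) set" where
  "state_seqs n T = ({0..T} \<rightarrow>\<^sub>E carrier_vec n)"

(* nested_phi phi0 phi u x t = phi_t {x(t), u(t), phi_(t-1) {..., phi_0 {x(0), u(0)} ...}} *)
fun nested_phi ::
  "(real vec \<Rightarrow> real vec \<Rightarrow> real vec) \<Rightarrow>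
   (nat \<Rightarrow> real vec \<Rightarrow> real vec \<Rightarrow> real vec \<Rightarrow> real vec) \<Rightarrow>
   (nat \<Rightarrow> real vec) \<Rightarrow> (nat \<Rightarrow> real vec) \<Rightarrow> nat \<Rightarrow> real vec" where
  "nested_phi \<phi>0 \<phi> u x 0 = \<phi>0 (x 0) (u 0)"
| "nested_phi \<phi>0 \<phi> u x (Suc t) =
     \<phi> (Suc t) (x (Suc t)) (u (Suc t)) (nested_phi \<phi>0 \<phi> u x t)"

(* Meant for T >= 1. The values of J outside input_seqs p T and state_seqs n T are irrelevant.
   Demanding q >= 1 instead of q >= 0 makes no difference, as a state in R^0 can be padded
   to one in R^1. *)
definition forward_separable ::
  "nat \<Rightarrow> nat \<Rightarrow> nat \<Rightarrow> ((nat \<Rightarrow> real vec) \<Rightarrow> (nat \<Rightarrow> real vec) \<Rightarrow> real) \<Rightarrow> bool" where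
  "forward_separable p n T J \<longleftrightarrow>
     (\<exists>q \<phi>0 \<phi> \<phi>T.
        q \<ge> 1 \<and>
        \<phi>0 \<in> carrier_vec n \<rightarrow> carrier_vec p \<rightarrow> carrier_vec q \<and>
        (\<forall>t\<in>{1..T-1}. \<phi> t \<in> carrier_vec n \<rightarrow> carrier_vec p \<rightarrow> carrier_vec q \<rightarrow> carrier_vec q) \<and>
        (\<forall>u\<in>input_seqs p T. \<forall>x\<in>state_seqs n T.
           J u x = \<phi>T (x T) (nested_phi \<phi>0 \<phi> u x (T - 1))))"

end

theory Submission
  imports Defs
begin

text \<open>
  A maximum over stages can be accumulated in one forward pass: a state in \<open>\<real>\<^sup>1\<close> carries the largest
  stage cost seen so far, each \<open>\<phi>\<^sub>t\<close> compares it with the current stage cost, and \<open>\<phi>\<^sub>T\<close> compares the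
  result with the terminal cost.
\<close>

definition singleton_vec :: "real \<Rightarrow> real vec" where
  "singleton_vec r = vec 1 (\<lambda>_. r)"

lemma singleton_vec_carrier: "singleton_vec r \<in> carrier_vec 1"
  by (simp add: singleton_vec_def)

lemma singleton_vec_index: "singleton_vec r $ 0 = r"
  by (simp add: singleton_vec_def)

lemma SUP_atLeast0AtMost_Suc_real:
  fixes f :: "nat \<Rightarrow> real"
  shows "(SUP k\<in>{0..Suc t}. f k) = max (f (Suc t)) (SUP k\<in>{0..t}. f k)"
proof -
  have "(SUP k\<in>{0..Suc t}. f k) = Sup (insert (f (Suc t)) (f ` {0..t}))"
    by (simp add: atLeast0_atMost_Suc)
  also have "\<dots> = max (f (Suc t)) (SUP k\<in>{0..t}. f k)"
    by (subst cSup_insert) (simp_all add: sup_max)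
  finally show ?thesis .
qed

lemma nested_phi_running_max:
  "nested_phi (\<lambda>y v. singleton_vec (c 0 v y))
     (\<lambda>k y v w. singleton_vec (max (c k v y) (w $ 0))) u x t
   = singleton_vec (SUP k\<in>{0..t}. c k (u k) (x k))"
  by (induction t) (simp_all only: nested_phi.simps SUP_atLeast0AtMost_Suc_real
      singleton_vec_index, simp)

theorem lemma3:
  fixes p n T :: nat
    and c :: "nat \<Rightarrow> real vec \<Rightarrow> real vec \<Rightarrow> real"
    and cT :: "real vec \<Rightarrow> real"
  assumes "T \<ge> 1"
  shows "forward_separable p n T
           (\<lambda>u x. max (SUP k\<in>{0..T-1}. c k (u k) (x k)) (cT (x T)))"
  unfolding forward_separable_def
proof (intro exI conjI ballI)
  show "(1::nat) \<le> 1" by simp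
  show "(\<lambda>y v. singleton_vec (c 0 v y)) \<in> carrier_vec n \<rightarrow> carrier_vec p \<rightarrow> carrier_vec 1"
    by (intro Pi_I singleton_vec_carrier)
  show "(\<lambda>k y v w. singleton_vec (max (c k v y) (w $ 0))) t
      \<in> carrier_vec n \<rightarrow> carrier_vec p \<rightarrow> carrier_vec 1 \<rightarrow> carrier_vec 1" for t
    by (intro Pi_I singleton_vec_carrier)
  show "max (SUP k\<in>{0..T-1}. c k (u k) (x k)) (cT (x T))
      = (\<lambda>y w. max (w $ 0) (cT y)) (x T)
          (nested_phi (\<lambda>y v. singleton_vec (c 0 v y))
            (\<lambda>k y v w. singleton_vec (max (c k v y) (w $ 0))) u x (T - 1))" for u x
    by (simp only: nested_phi_running_max singleton_vec_index)
qed

end
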